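(* Let $\mu>0$ and let a rate $0<R<1$ be given. Then there exist constants $c_1,c_2>0$ such that for all sufficiently large $n$, with $k=nR$, $$c_1\frac{1}{n}\le\left|nT_{\rm avg}^{\rm MDS}-nT_{\rm avg}^{\rm BRC}\right|\le c_2\frac{\log_2 n}{n}.$$ In particular, the normalized average execution time $nT_{\rm avg}^{\rm BRC}$ of binary random linear codes approaches $nT_{\rm avg}^{\rm MDS}$ as $n$ grows large.
   Context: Here $n$ ranges over positive integers for which $k=nR$ is an integer. System model. A computational job is divided equally into $k$ tasks, encoded by an $(n,k)$ linear code with generator matrix $\mathbf{G}$ into $n$ encoded tasks, and the $j$-th encoded task is assigned to the $j$-th of $n$ servers. The run times $T_1,\dots,T_n$ of the servers are i.i.d. (and independent of the choice of code) with shifted-exponential distribution $\Pr(T_i\le t)=1-\exp(-\mu(kt-1))$ for $t\ge 1/k$, and $\Pr(T_i\le t)=0$ for $t<1/k$, where $\mu$ is the straggling parameter. An encoded task not completed by time $t$ is regarded as erased. Under optimal (MAP) decoding, a set $S\subseteq\{1,\dots,n\}$ of unerased symbols is decodable if and only if the columns of $\mathbf{G}$ indexed by $S$ form a matrix of rank $k$. The total job completion time $T$ is the first time $t$ at which $\{i:T_i\le t\}$ is decodable, and the average execution time is $\mathbb{E}[T]$. $T_{\rm avg}^{\rm BRC}$ is the average execution time (averaged also over the code) under MAP decoding when $\mathbf{G}$ is drawn from the ensemble $\mathcal{R}(n,k)$, i.e. uniformly at random from all $k\times n$ matrices over $\mathbb{F}_2$ of rank $k$ (rank over $\mathbb{F}_2$).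 $T_{\rm avg}^{\rm MDS}$ is the average execution time with an $(n,k)$ MDS code (over a sufficiently large field), for which every set of $k$ unerased symbols, and no smaller set, is decodable; explicitly $T_{\rm avg}^{\rm MDS}=\frac1k+\frac{1}{\mu k}\sum_{i=n-k+1}^{n}\frac1i$. *)

theory Defs
  imports
    "HOL-Probability.Probability"
    "HOL-Library.Z2"
    "Jordan_Normal_Form.DL_Rank_Submatrix"
begin

text \<open>
  The law of one server's run time, given by its distribution function. It is meaningful for
  \<^term>\<open>\<mu> > 0\<close> and \<^term>\<open>k > 0\<close>; see \<open>run_time_law_cdf\<close> below.
\<close>

definition run_time_cdf :: "real \<Rightarrow> nat \<Rightarrow> real \<Rightarrow> real" where
  "run_time_cdf \<mu> k t =
     (if t < 1 / real k then 0 else 1 - exp (- (\<mu> * (real k * t - 1))))"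

definition run_time_law :: "real \<Rightarrow> nat \<Rightarrow> real measure" where
  "run_time_law \<mu> k = interval_measure (run_time_cdf \<mu> k)"

text \<open>
  Servers are indexed by \<^term>\<open>{..<n}\<close>. The predicate \<open>D\<close> tells which sets of unerased
  symbols are decodable. The infimum is attained whenever \<open>D\<close> is upward closed, holds for
  \<^term>\<open>{..<n}\<close> and fails for the empty set, so it is the first time at which the set of
  finished servers is decodable.
\<close>

definition completion_time :: "nat \<Rightarrow> (nat set \<Rightarrow> bool) \<Rightarrow> (nat \<Rightarrow> real) \<Rightarrow> real" where
  "completion_time n D x = Inf {t. D {i. i < n \<and> x i \<le> t}}"

definition avg_time :: "real \<Rightarrow> nat \<Rightarrow> nat \<Rightarrow> (nat set \<Rightarrow> bool) \<Rightarrow> real" where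
  "avg_time \<mu> n k D =
     (\<integral>x. completion_time n D x \<partial>(\<Pi>\<^sub>M i\<in>{..<n}. run_time_law \<mu> k))"

definition decodable :: "nat \<Rightarrow> 'a::field mat \<Rightarrow> nat set \<Rightarrow> bool" where
  "decodable k G S \<longleftrightarrow> vec_space.rank k (submatrix G UNIV S) = k"

definition full_rank_mats :: "nat \<Rightarrow> nat \<Rightarrow> bit mat set" where
  "full_rank_mats n k = {G \<in> carrier_mat k n. vec_space.rank k G = k}"

text \<open>
  The code is independent of the run times, so the average over both is the average over the
  code of the average execution time of a fixed code.
\<close>

definition T_BRC :: "real \<Rightarrow> nat \<Rightarrow> nat \<Rightarrow> real" where
  "T_BRC \<mu> n k =
     measure_pmf.expectation (pmf_of_set (full_rank_mats n k))
       (\<lambda>G. avg_time \<mu> n k (decodable k G))"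

text \<open>
  The average execution time is the same for all MDS codes over all fields, so it is defined
  from the sets that an MDS code can decode, without choosing a code; see \<open>avg_time_mds\<close> below.
\<close>

definition T_MDS :: "real \<Rightarrow> nat \<Rightarrow> nat \<Rightarrow> real" where
  "T_MDS \<mu> n k = avg_time \<mu> n k (\<lambda>S. k \<le> card S)"

definition mds_generator :: "nat \<Rightarrow> nat \<Rightarrow> 'a::field mat \<Rightarrow> bool" where
  "mds_generator n k G \<longleftrightarrow>
     G \<in> carrier_mat k n \<and> (\<forall>S\<subseteq>{..<n}. card S = k \<longrightarrow> decodable k G S)"


lemma
  assumes "\<mu> > 0" "k > 0"
  shows real_distribution_run_time_law: "real_distribution (run_time_law \<mu> k)"
    and run_time_law_cdf: "measure (run_time_law \<mu> k) {..t} = run_time_cdf \<mu> k t"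
proof -
  have eq: "run_time_cdf \<mu> k t = 1 - exp (- (\<mu> * max 0 (real k * t - 1)))" for t
    using assms by (auto simp: run_time_cdf_def max_def field_simps)
  have mono: "run_time_cdf \<mu> k x \<le> run_time_cdf \<mu> k y" if "x \<le> y" for x y
  proof -
    have "real k * x \<le> real k * y" using that by (intro mult_left_mono) auto
    hence "\<mu> * max 0 (real k * x - 1) \<le> \<mu> * max 0 (real k * y - 1)"
      using assms by (intro mult_left_mono max.mono) auto
    thus ?thesis by (simp add: eq)
  qed
  have cont: "continuous (at_right a) (run_time_cdf \<mu> k)" for a
    unfolding eq[abs_def] by (intro continuous_intros)
  have bot: "(run_time_cdf \<mu> k \<longlongrightarrow> 0) at_bot"
  proof (rule tendsto_eventually)
    show "eventually (\<lambda>t. run_time_cdf \<mu> k t = 0) at_bot"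
      using eventually_gt_at_bot[of "1 / real k"]
      by eventually_elim (simp add: run_time_cdf_def)
  qed
  have top: "(run_time_cdf \<mu> k \<longlongrightarrow> 1) at_top"
  proof (rule Lim_transform_eventually)
    have "filterlim (\<lambda>t. real k * t) at_top at_top"
      using assms by (intro filterlim_tendsto_pos_mult_at_top[OF tendsto_const] filterlim_ident) auto
    hence "filterlim (\<lambda>t. - 1 + real k * t) at_top at_top"
      by (intro filterlim_tendsto_add_at_top[OF tendsto_const])
    hence "filterlim (\<lambda>t. \<mu> * (- 1 + real k * t)) at_top at_top"
      using assms by (intro filterlim_tendsto_pos_mult_at_top[OF tendsto_const]) auto
    hence "((\<lambda>t. exp (- (\<mu> * (- 1 + real k * t)))) \<longlongrightarrow> 0) at_top"
      by (intro filterlim_compose[OF exp_at_bot] filterlim_compose[OF filterlim_uminus_at_bot_at_top])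
    hence "((\<lambda>t. 1 - exp (- (\<mu> * (- 1 + real k * t)))) \<longlongrightarrow> 1 - 0) at_top"
      by (intro tendsto_diff tendsto_const)
    thus "((\<lambda>t. 1 - exp (- (\<mu> * (real k * t - 1)))) \<longlongrightarrow> 1) at_top"
      by (simp add: algebra_simps)
    show "eventually (\<lambda>t. 1 - exp (- (\<mu> * (real k * t - 1))) = run_time_cdf \<mu> k t) at_top"
      using eventually_ge_at_top[of "1 / real k"]
      by eventually_elim (simp add: run_time_cdf_def)
  qed
  show "real_distribution (run_time_law \<mu> k)"
    unfolding run_time_law_def
    by (rule real_distribution_interval_measure[OF mono cont bot top])
  show "measure (run_time_law \<mu> k) {..t} = run_time_cdf \<mu> k t"
    unfolding run_time_law_def
    by (rule measure_interval_measure_Iic[OF mono cont bot])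
qed

lemma (in vec_space) rank_le_nr:
  assumes "A \<in> carrier_mat n nc"
  shows "rank A \<le> n"
proof -
  obtain S where S: "finite S" "maximal S (\<lambda>T. T \<subseteq> set (cols A) \<and> lin_indpt T)"
    using maximal_exists_superset[of "set (cols A)" "\<lambda>T. T \<subseteq> set (cols A) \<and> lin_indpt T" "{}"]
    by (auto simp: lin_dep_def)
  have "S \<subseteq> carrier_vec n" "lin_indpt S"
    using S(2) cols_dim[of A] assms by (auto simp: maximal_def)
  hence "card S \<le> n"
    using li_le_dim(2)[of S] dim_is_n fin_dim by auto
  thus ?thesis
    using rank_card_indpt[OF assms S(2)] by simp
qed

lemma full_rank_mats_finite: "finite (full_rank_mats n k)"
proof (rule finite_subset)
  let ?P = "PiE ({..<k} \<times> {..<n}) (\<lambda>_. UNIV :: bit set)"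
  have fin: "finite (UNIV :: bit set)"
  proof (rule finite_subset)
    show "(UNIV :: bit set) \<subseteq> {0, 1}"
    proof
      fix b :: bit
      show "b \<in> {0, 1}" by (cases b) simp_all
    qed
  qed simp
  thus "finite (mat k n ` ?P)"
    by (intro finite_imageI finite_PiE) auto
  show "full_rank_mats n k \<subseteq> mat k n ` ?P"
  proof
    fix G assume "G \<in> full_rank_mats n k"
    hence G: "G \<in> carrier_mat k n" by (simp add: full_rank_mats_def)
    let ?g = "restrict (\<lambda>ij. G $$ ij) ({..<k} \<times> {..<n})"
    have "G = mat k n ?g"
      using G by (intro eq_matI) auto
    moreover have "?g \<in> ?P" by simp
    ultimately show "G \<in> mat k n ` ?P" using image_eqI[of G "mat k n" ?g ?P] by simp
  qed
qed

lemma full_rank_mats_nonempty: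
  assumes "k \<le> n"
  shows "full_rank_mats n k \<noteq> {}"
proof -
  define G :: "bit mat" where "G = mat k n (\<lambda>(i, j). if i = j then 1 else 0)"
  have G: "G \<in> carrier_mat k n" by (simp add: G_def)
  have cK: "{j. j < n \<and> j < k} = {..<k}" using assms by auto
  have pk: "pick {..<k} j = j" if "j < k" for j
  proof -
    have "{a \<in> {..<k}. a < j} = {..<j}" using that by auto
    thus ?thesis using pick_card_in_set[of j "{..<k}"] that by simp
  qed
  have "submatrix G UNIV {..<k} = 1\<^sub>m k"
    using assms by (intro eq_matI) (auto simp: submatrix_def G_def cK pick_UNIV pk)
  hence "det (submatrix G UNIV {..<k}) \<noteq> 0" by simp
  from vec_space.rank_gt_minor[OF G this] have "k \<le> vec_space.rank k G"
    by (simp add: cK)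
  with vec_space.rank_le_nr[OF G] have "vec_space.rank k G = k" by simp
  with G show ?thesis by (auto simp: full_rank_mats_def)
qed

lemma set_cols_submatrix_UNIV:
  assumes G: "G \<in> carrier_mat k n" and S: "S \<subseteq> {..<n}"
  shows "set (cols (submatrix G UNIV S)) = col G ` S"
proof -
  have cS: "{j. j < dim_col G \<and> j \<in> S} = S" using G S by auto
  have fS: "finite S" using S finite_subset by blast
  have dim: "dim_row (submatrix G UNIV S) = k" "dim_col (submatrix G UNIV S) = card S"
    using G cS by (auto simp: dim_submatrix)
  have "col (submatrix G UNIV S) j = col G (pick S j)" if "j < card S" for j
  proof (rule eq_vecI)
    have p: "pick S j \<in> S" using pick_in_set_le[OF that] .
    show "dim_vec (col (submatrix G UNIV S) j) = dim_vec (col G (pick S j))"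
      using G dim by simp
    fix i assume "i < dim_vec (col G (pick S j))"
    hence i: "i < k" using G by simp
    have "submatrix G UNIV S $$ (i, j) = G $$ (i, pick S j)"
      using submatrix_index[of i G UNIV j S] i that cS G by (simp add: pick_UNIV)
    moreover have "pick S j < n" using p S by auto
    ultimately show "vec_index (col (submatrix G UNIV S) j) i = vec_index (col G (pick S j)) i"
      using dim that i G by simp
  qed
  hence "set (cols (submatrix G UNIV S)) = (\<lambda>j. col G (pick S j)) ` {..<card S}"
    using dim by (auto simp: cols_def)
  moreover have "pick S ` {..<card S} = S"
  proof (intro equalityI subsetI)
    fix x assume x: "x \<in> S"
    have "{a \<in> S. a < x} \<subset> S" using x by auto
    hence "card {a \<in> S. a < x} < card S"
      by (rule psubset_card_mono[OF fS])
    thus "x \<in> pick S ` {..<card S}"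
      by (intro image_eqI[of _ _ "card {a \<in> S. a < x}"]) (simp_all add: pick_card_in_set[OF x])
  next
    fix x assume "x \<in> pick S ` {..<card S}"
    thus "x \<in> S" using pick_in_set_le by auto
  qed
  ultimately show ?thesis using image_image[of "col G" "pick S" "{..<card S}"] by simp
qed

lemma mds_generator_decodable_iff:
  fixes G :: "'a::field mat"
  assumes mds: "mds_generator n k G" and S: "S \<subseteq> {..<n}"
  shows "decodable k G S \<longleftrightarrow> k \<le> card S"
proof -
  have G: "G \<in> carrier_mat k n" using mds by (simp add: mds_generator_def)
  have dim: "submatrix G UNIV A \<in> carrier_mat k (card A)" if "A \<subseteq> {..<n}" for A
  proof -
    have "{j. j < dim_col G \<and> j \<in> A} = A" using G that by auto
    thus ?thesis using G dim_submatrix[of G UNIV A] by (intro carrier_matI) simp_all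
  qed
  interpret vec_space "TYPE('a)" k .
  show ?thesis
  proof
    assume "decodable k G S"
    thus "k \<le> card S" using rank_le_nc[OF dim[OF S]] by (simp add: decodable_def)
  next
    assume "k \<le> card S"
    then obtain A where A: "A \<subseteq> S" "card A = k" by (meson obtain_subset_with_card_n)
    hence An: "A \<subseteq> {..<n}" using S by auto
    let ?A = "submatrix G UNIV A"
    have r: "rank ?A = k" using mds A An by (auto simp: mds_generator_def decodable_def)
    have dA: "?A \<in> carrier_mat k k" using dim[OF An] A by simp
    have dist: "distinct (cols ?A)" using non_distinct_low_rank[OF dA] r by auto
    have li: "lin_indpt (set (cols ?A))" using full_rank_lin_indpt[OF dA r dist] .
    have "set (cols ?A) \<subseteq> set (cols (submatrix G UNIV S))"
      using set_cols_submatrix_UNIV[OF G An] set_cols_submatrix_UNIV[OF G S] A(1) by auto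
    from rank_ge_card_indpt[OF dim[OF S] this li]
    have "card (set (cols ?A)) \<le> rank (submatrix G UNIV S)" .
    moreover have "card (set (cols ?A)) = k"
      using distinct_card[OF dist] dA by simp
    ultimately show "decodable k G S"
      using rank_le_nr[OF dim[OF S]] by (simp add: decodable_def)
  qed
qed

lemma avg_time_mds:
  assumes "mds_generator n k G"
  shows "avg_time \<mu> n k (decodable k G) = T_MDS \<mu> n k"
proof -
  have "decodable k G {i. i < n \<and> x i \<le> t} \<longleftrightarrow> k \<le> card {i. i < n \<and> x i \<le> t}"
    for x :: "nat \<Rightarrow> real" and t
    by (rule mds_generator_decodable_iff[OF assms]) auto
  thus ?thesis by (simp add: T_MDS_def avg_time_def completion_time_def)
qed

end

theory Submission
  imports Defs "HOL-Real_Asymp.Real_Asymp"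
begin

text \<open>
  Write the mean completion time as the integral of \<open>P(T > t)\<close>. A set \<open>S\<close> of size \<open>m\<close> with
  \<open>0 < m < n\<close> is the set of finished servers for an expected time \<open>1 / (\<mu> k (n - m) binom(n, m))\<close>, and
  an undecodable \<open>S\<close> contributes exactly this amount. Hence \<open>T\<^sub>B\<^sub>R\<^sub>C - T\<^sub>M\<^sub>D\<^sub>S\<close> is the sum over
  \<open>k \<le> m < n\<close> of \<open>p\<^sub>m / (\<mu> k (n - m))\<close>, where \<open>p\<^sub>m\<close> is the probability that \<open>m\<close> columns of the random
  matrix of full rank do not have rank \<open>k\<close>.

  A union bound over the vectors of the left kernel gives \<open>p\<^sub>m \<le> 2 \<cdot> 2 ^ (k - m)\<close>, and the sum is at most
  \<open>8 / (\<mu> k (n - k))\<close>. At least half of all square matrices over the field with two elements are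
  singular, so \<open>p\<^sub>k \<ge> 1/4\<close> and the term \<open>m = k\<close> alone gives \<open>1 / (4 \<mu> k (n - k))\<close>. The gap, multiplied
  by \<open>n\<close>, is thus of exact order \<open>1 / n\<close>.
\<close>

section \<open>Rank over the field with two elements\<close>

no_notation inner (infix "\<bullet>" 70)
no_notation Finite_Cartesian_Product.vec.vec_nth (infixl "$" 90)

lemma UNIV_bit: "(UNIV :: bit set) = {0, 1}"
proof -
  have "b \<in> {0, 1}" for b :: bit by (cases b) simp_all
  thus ?thesis by auto
qed

lemma card_UNIV_bit: "card (UNIV :: bit set) = 2"
  by (simp add: UNIV_bit)

lemma bit_vec_finite: "finite (carrier_vec k :: bit vec set)"
  and bit_vec_card: "card (carrier_vec k :: bit vec set) = 2 ^ k"
proof -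
  have "bij_betw (\<lambda>v. restrict (vec_index v) {..<k}) (carrier_vec k :: bit vec set)
          (PiE {..<k} (\<lambda>_. UNIV))"
    by (rule bij_betw_byWitness[where f' = "vec k"])
       (auto simp: restrict_def PiE_def extensional_def fun_eq_iff intro!: eq_vecI)
  moreover have "card (PiE {..<k} (\<lambda>_. UNIV :: bit set)) = 2 ^ k"
    by (simp add: card_PiE card_UNIV_bit)
  moreover have "finite (PiE {..<k} (\<lambda>_. UNIV :: bit set))"
    by (intro finite_PiE) (auto simp: UNIV_bit)
  ultimately show "finite (carrier_vec k :: bit vec set)"
    and "card (carrier_vec k :: bit vec set) = 2 ^ k"
    using bij_betw_finite bij_betw_same_card by metis+
qed

lemma vec_add_right_cancel:
  fixes u v w :: "'a::cancel_semigroup_add vec"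
  assumes "u + w = v + w" "u \<in> carrier_vec k" "v \<in> carrier_vec k" "w \<in> carrier_vec k"
  shows "u = v"
proof (rule eq_vecI)
  fix i assume "i < dim_vec v"
  thus "u $ i = v $ i" using arg_cong[OF assms(1), of "\<lambda>x. x $ i"] assms(2-) by simp
qed (use assms in auto)

lemma bit_add_eq_0_iff: "a + b = 0 \<longleftrightarrow> a = (b :: bit)"
  by (cases a; cases b) simp_all

text \<open>Pigeonhole: the \<open>2 ^ k\<close> vectors have only \<open>2 ^ card B\<close> possible products with \<open>B\<close>, and the
  difference of two vectors with the same products is orthogonal to \<open>B\<close>.\<close>
lemma bit_vec_orthogonal_exists:
  fixes B :: "bit vec set"
  assumes B: "B \<subseteq> carrier_vec k" "finite B" "card B < k"
  obtains y where "y \<in> carrier_vec k" "y \<noteq> 0\<^sub>v k" "\<And>b. b \<in> B \<Longrightarrow> y \<bullet> b = 0"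
proof -
  define f where "f y = restrict (\<lambda>b. y \<bullet> b) B" for y :: "bit vec"
  have "card (f ` carrier_vec k) \<le> card (PiE B (\<lambda>_. UNIV :: bit set))"
    by (intro card_mono finite_PiE) (auto simp: f_def B UNIV_bit)
  also have "\<dots> = 2 ^ card B" using B by (simp add: card_PiE card_UNIV_bit)
  also have "\<dots> < card (carrier_vec k :: bit vec set)" using B by (simp add: bit_vec_card)
  finally obtain u v where uv: "u \<in> carrier_vec k" "v \<in> carrier_vec k" "u \<noteq> v" "f u = f v"
    using pigeonhole[of f "carrier_vec k"] by (auto simp: inj_on_def)
  show ?thesis
  proof
    show "u - v \<in> carrier_vec k" using uv by simp
    show "u - v \<noteq> 0\<^sub>v k"
    proof
      assume "u - v = 0\<^sub>v k"
      hence "u $ i - v $ i = 0" if "i < k" for i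
        using arg_cong[OF \<open>u - v = 0\<^sub>v k\<close>, of "\<lambda>w. w $ i"] that uv(1,2)
        by (metis carrier_vecD index_minus_vec(1) index_zero_vec(1))
      hence "u = v" using uv(1,2) by (intro eq_vecI) (simp_all only: carrier_vecD right_minus_eq)
      with uv show False by simp
    qed
    fix b assume b: "b \<in> B"
    with uv(4) have "u \<bullet> b = v \<bullet> b" by (auto simp: f_def fun_eq_iff restrict_def split: if_splits)
    moreover have "b \<in> carrier_vec k" using b B by auto
    ultimately show "(u - v) \<bullet> b = 0" using uv by (simp add: minus_scalar_prod_distrib)
  qed
qed

lemma (in vec_space) orthogonal_span:
  assumes "B \<subseteq> carrier_vec n" "y \<in> carrier_vec n" "\<And>b. b \<in> B \<Longrightarrow> y \<bullet> b = 0" "x \<in> span B"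
  shows "y \<bullet> x = 0"
  using assms in_orthogonal_complement_span[of B] by (auto simp: orthogonal_complement_def)

text \<open>Take a maximal independent set of columns. A column outside its span could be adjoined,
  against maximality; and \<open>n\<close> independent vectors in dimension \<open>n\<close> form a
  basis.\<close>

lemma (in vec_space) rank_basis_of_cols:
  assumes A: "A \<in> carrier_mat n m"
  obtains B where "B \<subseteq> set (cols A)" "finite B" "card B = rank A" "set (cols A) \<subseteq> span B"
    "rank A = n \<Longrightarrow> span B = carrier_vec n"
proof -
  have cA: "set (cols A) \<subseteq> carrier_vec n" using A cols_dim by blast
  obtain B where B: "finite B" "maximal B (\<lambda>T. T \<subseteq> set (cols A) \<and> lin_indpt T)"
    using maximal_exists_superset[of "set (cols A)" "\<lambda>T. T \<subseteq> set (cols A) \<and> lin_indpt T" "{}"]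
    by (auto simp: lin_dep_def)
  have BA: "B \<subseteq> set (cols A)" and li: "lin_indpt B" using B(2) by (auto simp: maximal_def)
  have Bc: "B \<subseteq> carrier_vec n" using BA cA by auto
  have r: "card B = rank A" using rank_card_indpt[OF A B(2)] by simp
  have "c \<in> span B" if c: "c \<in> set (cols A)" for c
  proof (rule ccontr)
    assume nc: "c \<notin> span B"
    have cc: "c \<in> carrier_vec n" using c cA by auto
    have cB: "c \<notin> B" using nc in_own_span[of B] Bc by auto
    have "lin_indpt (insert c B)"
      using nc lin_dep_iff_in_span[of B c] Bc li cc cB by auto
    hence "insert c B = B" using B(2) BA c by (auto simp: maximal_def)
    with cB show False by auto
  qed
  moreover have "span B = carrier_vec n" if "rank A = n"
  proof -
    have "basis B" using dim_li_is_basis[of B] r that B(1) Bc li dim_is_n by auto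
    thus ?thesis by (simp add: basis_def)
  qed
  ultimately show ?thesis using that[OF BA B(1) r] by blast
qed

text \<open>Makes rank accessible to a union bound. If the columns span, a \<open>y\<close>
  orthogonal to them is orthogonal to every unit vector. If the rank is below \<open>k\<close>, a
  basis of the column span has fewer than \<open>k\<close> elements, and
  \<open>bit_vec_orthogonal_exists\<close> yields a nonzero \<open>y\<close> orthogonal to it, hence
  to all columns.\<close>

lemma bit_rank_eq_iff_left_kernel:
  fixes A :: "bit mat"
  assumes A: "A \<in> carrier_mat k m"
  shows "vec_space.rank k A = k \<longleftrightarrow>
    (\<forall>y\<in>carrier_vec k. (\<forall>c\<in>set (cols A). y \<bullet> c = 0) \<longrightarrow> y = 0\<^sub>v k)"
proof -
  interpret vec_space "TYPE(bit)" k .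
  obtain B where B: "B \<subseteq> set (cols A)" "finite B" "card B = rank A" "set (cols A) \<subseteq> span B"
    "rank A = k \<Longrightarrow> span B = carrier_vec k"
    using rank_basis_of_cols[OF A] by blast
  have Bc: "B \<subseteq> carrier_vec k" using B(1) A cols_dim by blast
  show ?thesis
  proof
    assume "rank A = k"
    hence sp: "span B = carrier_vec k" by (rule B)
    show "\<forall>y\<in>carrier_vec k. (\<forall>c\<in>set (cols A). y \<bullet> c = 0) \<longrightarrow> y = 0\<^sub>v k"
    proof (intro ballI impI eq_vecI)
      fix y i assume y: "y \<in> carrier_vec k" "\<forall>c\<in>set (cols A). y \<bullet> c = 0"
        and i: "i < dim_vec (0\<^sub>v k)"
      have "y \<bullet> unit_vec k i = 0"
        by (rule orthogonal_span[of B]) (use Bc B(1) y i sp in auto)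
      thus "y $ i = 0\<^sub>v k $ i" using y i by simp
    qed auto
  next
    assume ker: "\<forall>y\<in>carrier_vec k. (\<forall>c\<in>set (cols A). y \<bullet> c = 0) \<longrightarrow> y = 0\<^sub>v k"
    show "rank A = k"
    proof (rule ccontr)
      assume "rank A \<noteq> k"
      hence "card B < k" using rank_le_nr[OF A] B(3) by simp
      then obtain y where y: "y \<in> carrier_vec k" "y \<noteq> 0\<^sub>v k" "\<And>b. b \<in> B \<Longrightarrow> y \<bullet> b = 0"
        using bit_vec_orthogonal_exists[OF Bc B(2)] by blast
      have "y \<bullet> c = 0" if "c \<in> set (cols A)" for c
        by (rule orthogonal_span[of B]) (use Bc y B(4) that in auto)
      with ker y show False by auto
    qed
  qed
qed

text \<open>The vectors indexed by \<open>S\<close> span \<open>carrier_vec k\<close>, stated dually: no nonzero functional vanishes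
  on all of them.\<close>
definition spanning :: "nat \<Rightarrow> (nat \<Rightarrow> bit vec) \<Rightarrow> nat set \<Rightarrow> bool" where
  "spanning k g S \<longleftrightarrow> (\<forall>y\<in>carrier_vec k. (\<forall>j\<in>S. y \<bullet> g j = 0) \<longrightarrow> y = 0\<^sub>v k)"

text \<open>The left kernel sees only the set of columns, so the renumbering done by
  \<open>submatrix\<close> disappears.\<close>

lemma decodable_iff_spanning:
  fixes G :: "bit mat"
  assumes G: "G \<in> carrier_mat k n" and S: "S \<subseteq> {..<n}"
  shows "decodable k G S \<longleftrightarrow> spanning k (col G) S"
proof -
  have "submatrix G UNIV S \<in> carrier_mat k (dim_col (submatrix G UNIV S))"
    using G by (intro carrier_matI) (simp_all add: dim_submatrix)
  from bit_rank_eq_iff_left_kernel[OF this] show ?thesis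
    by (simp add: decodable_def spanning_def set_cols_submatrix_UNIV[OF G S])
qed

lemma full_rank_iff_spanning:
  fixes G :: "bit mat"
  assumes G: "G \<in> carrier_mat k n"
  shows "G \<in> full_rank_mats n k \<longleftrightarrow> spanning k (col G) {..<n}"
proof -
  have "set (cols G) = col G ` {..<n}" using G by (auto simp: cols_def)
  with bit_rank_eq_iff_left_kernel[OF G] G show ?thesis
    by (simp add: full_rank_mats_def spanning_def)
qed

lemma spanning_mono: "spanning k g S \<Longrightarrow> S \<subseteq> S' \<Longrightarrow> spanning k g S'"
  by (auto simp: spanning_def)

lemma spanning_cong: "(\<And>j. j \<in> S \<Longrightarrow> g j = h j) \<Longrightarrow> spanning k g S = spanning k h S"
  by (auto simp: spanning_def)

text \<open>By the same pigeonhole, fewer than \<open>k\<close> vectors have a common nonzero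
  annihilator.\<close>

lemma spanning_card_le:
  assumes "spanning k g S" "finite S" "g ` S \<subseteq> carrier_vec k"
  shows "k \<le> card S"
proof (rule ccontr)
  assume "\<not> k \<le> card S"
  hence "card (g ` S) < k" using card_image_le[OF assms(2), of g] by linarith
  then obtain y where "y \<in> carrier_vec k" "y \<noteq> 0\<^sub>v k" "\<And>b. b \<in> g ` S \<Longrightarrow> y \<bullet> b = 0"
    using bit_vec_orthogonal_exists[of "g ` S" k] assms by blast
  with assms(1) show False by (auto simp: spanning_def)
qed

section \<open>Counting families of columns\<close>

abbreviation col_families :: "nat \<Rightarrow> nat \<Rightarrow> (nat \<Rightarrow> bit vec) set" where
  "col_families n k \<equiv> PiE {..<n} (\<lambda>_. carrier_vec k)"

lemma col_families_finite: "finite (col_families n k)"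
  by (intro finite_PiE) (auto simp: bit_vec_finite)

lemma col_families_card: "card (col_families n k) = 2 ^ (k * n)"
  by (simp add: card_PiE bit_vec_card power_mult)

text \<open>Passes from matrices to functions, which are counted as a product over the columns;
  \<open>restrict\<close> gives the extensional form that \<open>PiE\<close> demands.\<close>

lemma bij_betw_col_families:
  "bij_betw (\<lambda>G. restrict (col G) {..<n}) (carrier_mat k n :: bit mat set) (col_families n k)"
  by (rule bij_betw_byWitness[where f' = "\<lambda>g. mat k n (\<lambda>(i, j). g j $ i)"])
     (auto simp: restrict_def PiE_def extensional_def fun_eq_iff Pi_def intro!: eq_matI eq_vecI)

lemma bij_betw_subset_Collect:
  assumes "bij_betw f A B" "\<And>x. x \<in> A \<Longrightarrow> P x \<longleftrightarrow> Q (f x)"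
  shows "bij_betw f {x \<in> A. P x} {y \<in> B. Q y}"
  using assms unfolding bij_betw_def inj_on_def by blast

lemma card_mats_eq_card_col_families:
  assumes "\<And>G. G \<in> carrier_mat k n \<Longrightarrow> P G \<longleftrightarrow> Q (restrict (col G) {..<n})"
  shows "card {G \<in> carrier_mat k n :: bit mat set. P G} = card {g \<in> col_families n k. Q g}"
proof (rule bij_betw_same_card)
  show "bij_betw (\<lambda>G. restrict (col G) {..<n}) {G \<in> carrier_mat k n. P G} {g \<in> col_families n k. Q g}"
  proof (rule bij_betw_subset_Collect[OF bij_betw_col_families])
  qed (use assms in auto)
qed

text \<open>Adding a unit vector at a nonzero coordinate of \<open>y\<close> changes the product
  with \<open>y\<close>, so it maps the orthogonal vectors injectively to the others.\<close>

lemma bit_orthogonal_card: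
  fixes y :: "bit vec"
  assumes y: "y \<in> carrier_vec k" "y \<noteq> 0\<^sub>v k"
  shows "2 * card {v \<in> carrier_vec k. y \<bullet> v = 0} \<le> 2 ^ k"
proof -
  let ?Z = "{v \<in> carrier_vec k. y \<bullet> v = 0}" and ?N = "{v \<in> carrier_vec k. y \<bullet> v \<noteq> 0}"
  obtain i where i: "i < k" "y $ i \<noteq> 0"
    using y by (metis carrier_vecD eq_vecI index_zero_vec(1) index_zero_vec(2))
  have e: "unit_vec k i \<in> carrier_vec k" by simp
  have "inj_on (\<lambda>v. v + unit_vec k i) ?Z"
    using e by (intro inj_onI) (auto dest: vec_add_right_cancel)
  moreover have "(\<lambda>v. v + unit_vec k i) ` ?Z \<subseteq> ?N"
    using i y by (auto simp: scalar_prod_add_distrib[OF y(1) _ e])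
  ultimately have "card ?Z \<le> card ?N"
    by (intro card_inj_on_le) (auto simp: bit_vec_finite)
  moreover have "card ?Z + card ?N = card (carrier_vec k :: bit vec set)"
    by (subst card_Un_disjoint[symmetric]) (auto simp: bit_vec_finite intro!: arg_cong[of _ _ card])
  ultimately show ?thesis by (simp add: bit_vec_card)
qed

text \<open>Union bound over the nonzero vectors \<open>y\<close> of a left kernel.\<close>
lemma not_spanning_card:
  assumes S: "S \<subseteq> {..<n}"
  shows "card {g \<in> col_families n k. \<not> spanning k g S} * 2 ^ card S \<le> 2 ^ k * 2 ^ (k * n)"
proof -
  let ?Y = "carrier_vec k - {0\<^sub>v k} :: bit vec set"
  let ?E = "\<lambda>y. {g \<in> col_families n k. \<forall>j\<in>S. y \<bullet> g j = 0}"
  have fS: "finite S" using S finite_subset by blast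
  have one: "card (?E y) * 2 ^ card S \<le> 2 ^ (k * n)" if y: "y \<in> ?Y" for y
  proof -
    let ?Z = "{v \<in> carrier_vec k. y \<bullet> v = 0}"
    \<comment> \<open>For a fixed \<open>y\<close> each column is constrained separately, so these
      families form a product set.\<close>
    have "?E y = PiE {..<n} (\<lambda>j. if j \<in> S then ?Z else carrier_vec k)" (is "_ = PiE _ ?F")
      using S by (auto simp: PiE_def Pi_def subset_iff)
    hence "card (?E y) = (\<Prod>j<n. card (?F j))" by (simp add: card_PiE)
    also have "\<dots> = (\<Prod>j\<in>{..<n} \<inter> S. card ?Z) * (\<Prod>j\<in>{..<n} - S. 2 ^ k)"
      by (subst prod.Int_Diff[of _ _ S]) (auto simp: bit_vec_card intro!: arg_cong2[of _ _ _ _ "(*)"] prod.cong)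
    also have "{..<n} \<inter> S = S" using S by auto
    finally have "card (?E y) * 2 ^ card S = (2 * card ?Z) ^ card S * 2 ^ (k * (n - card S))"
      using card_Diff_subset[OF fS S] by (simp add: power_mult_distrib power_mult)
    also have "\<dots> \<le> (2 ^ k) ^ card S * 2 ^ (k * (n - card S))"
      using bit_orthogonal_card[of y k] y by (intro mult_right_mono power_mono) auto
    also have "\<dots> = 2 ^ (k * n)"
      using card_mono[OF _ S] by (simp add: power_mult[symmetric] power_add[symmetric] add_mult_distrib2[symmetric])
    finally show ?thesis .
  qed
  have "card {g \<in> col_families n k. \<not> spanning k g S} \<le> card (\<Union>y\<in>?Y. ?E y)"
    by (intro card_mono finite_UN_I) (auto simp: bit_vec_finite col_families_finite spanning_def)
  also have "\<dots> \<le> (\<Sum>y\<in>?Y. card (?E y))"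
    by (intro card_UN_le) (auto simp: bit_vec_finite)
  finally have "card {g \<in> col_families n k. \<not> spanning k g S} * 2 ^ card S
      \<le> (\<Sum>y\<in>?Y. card (?E y) * 2 ^ card S)"
    by (simp add: sum_distrib_right[symmetric])
  also have "\<dots> \<le> (\<Sum>y\<in>?Y. 2 ^ (k * n))" by (intro sum_mono one)
  \<comment> \<open>Including the zero vector rounds the number of terms up to
    \<open>2 ^ k\<close>.\<close>
  also have "\<dots> \<le> (\<Sum>y\<in>(carrier_vec k :: bit vec set). 2 ^ (k * n))"
    by (intro sum_mono2) (auto simp: bit_vec_finite)
  finally show ?thesis by (simp add: bit_vec_card)
qed

text \<open>A nonzero functional that vanishes on the other \<open>k - 1\<close> vectors is 1 on both spanning choices of
  the \<open>j\<close>-th vector, hence 0 on their sum.\<close>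
lemma not_spanning_add:
  assumes g: "spanning k g S" "spanning k (g(j := v)) S" and S: "finite S" "card S = k" "j \<in> S"
    and c: "g ` S \<subseteq> carrier_vec k" "v \<in> carrier_vec k"
  shows "\<not> spanning k (g(j := g j + v)) S"
proof -
  have k: "k > 0" using S card_gt_0_iff by blast
  have "card (g ` (S - {j})) < k"
    using card_image_le[of "S - {j}" g] S k by simp
  then obtain y where y: "y \<in> carrier_vec k" "y \<noteq> 0\<^sub>v k" "\<And>b. b \<in> g ` (S - {j}) \<Longrightarrow> y \<bullet> b = 0"
    using bit_vec_orthogonal_exists[of "g ` (S - {j})" k] S c by blast
  have "y \<bullet> g j \<noteq> 0"
  proof
    assume "y \<bullet> g j = 0"
    hence "\<forall>i\<in>S. y \<bullet> g i = 0" using y by auto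
    with g(1) y show False unfolding spanning_def by blast
  qed
  moreover have "y \<bullet> v \<noteq> 0"
  proof
    assume "y \<bullet> v = 0"
    hence "\<forall>i\<in>S. y \<bullet> (g(j := v)) i = 0" using y by auto
    with g(2) y show False unfolding spanning_def by blast
  qed
  moreover have "g j \<in> carrier_vec k" using S c by auto
  ultimately have "y \<bullet> (g j + v) = 0"
    using y c by (simp add: scalar_prod_add_distrib[of _ k] bit_add_eq_0_iff)
  hence "\<forall>i\<in>S. y \<bullet> (g(j := g j + v)) i = 0" using y by auto
  with y show ?thesis unfolding spanning_def by blast
qed

text \<open>For fixed other columns choose, if possible, a column \<open>w\<close> completing them to a spanning family;
  adding \<open>w\<close> maps the spanning families injectively to the others.\<close>
lemma spanning_card_half:
  assumes S: "S \<subseteq> {..<n}" "card S = k" and k: "k > 0"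
  shows "2 ^ (k * n) \<le> 2 * card {g \<in> col_families n k. \<not> spanning k g S}"
proof -
  let ?A = "{g \<in> col_families n k. spanning k g S}" and ?B = "{g \<in> col_families n k. \<not> spanning k g S}"
  have fS: "finite S" using S finite_subset by blast
  obtain j where j: "j \<in> S" using S k by fastforce
  hence jn: "j < n" using S by auto
  \<comment> \<open>\<open>w\<close> is applied only to \<open>g(j := 0\<^sub>v k)\<close>, so it
    depends on the columns other than \<open>j\<close> alone. As \<open>f\<close> leaves those
    unchanged, \<open>f g\<close> determines the vector added, and \<open>f\<close> is injective on
    \<open>?A\<close>.\<close>
  define w where "w h = (SOME v. v \<in> carrier_vec k \<and> spanning k (h(j := v)) S)" for h
  define f where "f g = g(j := g j + w (g(j := 0\<^sub>v k)))" for g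
  have w: "w (g(j := 0\<^sub>v k)) \<in> carrier_vec k" "spanning k (g(j := w (g(j := 0\<^sub>v k)))) S"
    if "g \<in> ?A" for g
  proof -
    have "g j \<in> carrier_vec k \<and> spanning k ((g(j := 0\<^sub>v k))(j := g j)) S"
      using that jn by auto
    from someI[of "\<lambda>v. v \<in> carrier_vec k \<and> spanning k ((g(j := 0\<^sub>v k))(j := v)) S", OF this]
    show "w (g(j := 0\<^sub>v k)) \<in> carrier_vec k" "spanning k (g(j := w (g(j := 0\<^sub>v k)))) S"
      by (simp_all add: w_def)
  qed
  have "card ?A \<le> card ?B"
  proof (rule card_inj_on_le)
    show "inj_on f ?A"
    proof (rule inj_onI)
      fix g h assume gh: "g \<in> ?A" "h \<in> ?A" "f g = f h"
      have off: "g i = h i" if "i \<noteq> j" for i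
        using fun_cong[OF gh(3), of i] that by (simp add: f_def)
      hence eq: "g(j := 0\<^sub>v k) = h(j := 0\<^sub>v k)" by auto
      have "g j \<in> carrier_vec k" "h j \<in> carrier_vec k" using gh jn by auto
      hence "g j = h j"
        using fun_cong[OF gh(3), of j] w(1)[OF gh(1)] by (auto simp: f_def eq dest: vec_add_right_cancel)
      with off show "g = h" by (metis ext)
    qed
    show "f ` ?A \<subseteq> ?B"
    proof
      fix h assume "h \<in> f ` ?A"
      then obtain g where g: "g \<in> col_families n k" "spanning k g S" and h: "h = f g" by auto
      hence A: "g \<in> ?A" by simp
      have "g j \<in> carrier_vec k" using g jn by auto
      hence fg: "f g \<in> col_families n k"
        using g(1) w(1)[OF A] jn by (auto simp: f_def PiE_def extensional_def)
      have c: "g ` S \<subseteq> carrier_vec k" using g(1) S by auto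
      have "\<not> spanning k (f g) S"
        using not_spanning_add[OF g(2) w(2)[OF A] fS S(2) j c w(1)[OF A]] by (simp add: f_def)
      with fg h show "h \<in> ?B" by simp
    qed
  qed (simp add: col_families_finite)
  moreover have "card ?A + card ?B = card (col_families n k)"
    by (subst card_Un_disjoint[symmetric]) (auto simp: col_families_finite intro!: arg_cong[of _ _ card])
  ultimately show ?thesis by (simp add: col_families_card)
qed

section \<open>Average execution time of a decoder\<close>

text \<open>Covers both the decoder of a full-rank code and the threshold decoder of an MDS code, so
  that one formula for the mean serves both.\<close>

definition decoder :: "nat \<Rightarrow> (nat set \<Rightarrow> bool) \<Rightarrow> bool" where
  "decoder n D \<longleftrightarrow> D {..<n} \<and> \<not> D {} \<and> (\<forall>A B. A \<subseteq> B \<longrightarrow> B \<subseteq> {..<n} \<longrightarrow> D A \<longrightarrow> D B)"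

text \<open>The infimum is attained: the times at which decoding succeeds form a nonempty up-set
  bounded below, and the finished set stays constant for a while after any \<open>t\<close>, since
  there are only finitely many run times.\<close>

lemma completion_time_le_iff:
  assumes D: "decoder n D"
  shows "completion_time n D x \<le> t \<longleftrightarrow> D {i. i < n \<and> x i \<le> t}"
proof -
  define T where "T = {t. D {i. i < n \<and> x i \<le> t}}"
  have D_full: "D {..<n}" and D_empty: "\<not> D {}" using D by (simp_all add: decoder_def)
  have mono: "t \<in> T" if "s \<in> T" "s \<le> t" for s t
  proof -
    have "{i. i < n \<and> x i \<le> s} \<subseteq> {i. i < n \<and> x i \<le> t}" "{i. i < n \<and> x i \<le> t} \<subseteq> {..<n}"
      using that by auto
    thus ?thesis using D that(1) unfolding T_def decoder_def by blast
  qed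
  have "{i. i < n \<and> x i \<le> Max (x ` {..<n})} = {..<n}" by auto
  hence "Max (x ` {..<n}) \<in> T" using D_full by (simp add: T_def)
  hence T_ne: "T \<noteq> {}" by blast
  have "Min (x ` {..<n}) \<le> t" if t: "t \<in> T" for t
  proof -
    have "{i. i < n \<and> x i \<le> t} \<noteq> {}"
      using t D_empty unfolding T_def by (metis mem_Collect_eq)
    then obtain i where "i < n" "x i \<le> t" by auto
    moreover have "Min (x ` {..<n}) \<le> x i" using \<open>i < n\<close> by (intro Min_le) simp_all
    ultimately show ?thesis by linarith
  qed
  hence bdd: "bdd_below T" by (rule bdd_belowI)
  have "t \<in> T" if le: "Inf T \<le> t"
  proof -
    let ?B = "{y \<in> x ` {..<n}. t < y}"
    \<comment> \<open>The midpoint between \<open>t\<close> and the next run time after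
      \<open>t\<close>. The extra element \<open>t + 1\<close> keeps the set nonempty when no run
      time follows.\<close>
    define u where "u = (t + Min (insert (t + 1) ?B)) / 2"
    have u: "t < u" "u < Min (insert (t + 1) ?B)"
      by (simp_all add: u_def field_simps)
    have "x i \<le> u \<longleftrightarrow> x i \<le> t" if "i < n" for i
    proof
      assume "x i \<le> u"
      show "x i \<le> t"
      proof (rule ccontr)
        assume "\<not> x i \<le> t"
        hence "Min (insert (t + 1) ?B) \<le> x i" using that by (intro Min_le) auto
        with u(2) \<open>x i \<le> u\<close> show False by linarith
      qed
    qed (use u in auto)
    hence eq: "{i. i < n \<and> x i \<le> u} = {i. i < n \<and> x i \<le> t}" by auto
    have "Inf T < u" using le u by simp
    then obtain s where "s \<in> T" "s < u" using cInf_lessD[OF T_ne] by blast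
    hence "u \<in> T" using mono by auto
    thus ?thesis by (simp add: T_def eq)
  qed
  moreover have "Inf T \<le> t" if "t \<in> T" using cInf_lower[OF that bdd] .
  ultimately show ?thesis unfolding completion_time_def T_def by blast
qed

section \<open>Distribution of the set of finished servers\<close>

locale run_times =
  fixes \<mu> :: real and n k :: nat
  assumes mu: "0 < \<mu>" and k: "0 < k"
begin

abbreviation F where "F \<equiv> run_time_cdf \<mu> k"

abbreviation times where "times \<equiv> Pi\<^sub>M {..<n} (\<lambda>_. run_time_law \<mu> k)"

text \<open>The expected length of time for which the set of finished servers is a given set of size
  \<open>m < n\<close>; see \<open>tail_integral\<close>. For \<open>m = n\<close> the value is junk, \<open>1 / 0 = 0\<close>.\<close>
definition tail_weight :: "nat \<Rightarrow> real" where
  "tail_weight m = ((if m = 0 then 1 / k else 0) + 1 / (\<mu> * k * (real n - real m))) / (n choose m)"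

sublocale law: real_distribution "run_time_law \<mu> k"
  by (rule real_distribution_run_time_law[OF mu k])

sublocale times: finite_product_prob_space "\<lambda>_. run_time_law \<mu> k" "{..<n}"
  by unfold_locales auto

lemma F_nonneg: "0 \<le> F t" and F_le_1: "F t \<le> 1"
  using law.prob_le_1[of "{..t}"] measure_nonneg[of "run_time_law \<mu> k" "{..t}"]
  by (simp_all add: run_time_law_cdf[OF mu k])

lemma space_times: "space times = PiE {..<n} (\<lambda>_. UNIV)"
  by (simp add: space_PiM)

lemma finished_eq:
  assumes "S \<subseteq> {..<n}"
  shows "{x \<in> space times. {i. i < n \<and> x i \<le> t} = S}
           = PiE {..<n} (\<lambda>i. if i \<in> S then {..t} else {t<..})"
  using assms by (auto simp: space_times PiE_def Pi_def set_eq_iff not_le)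

lemma finished_sets:
  assumes "S \<subseteq> {..<n}"
  shows "{x \<in> space times. {i. i < n \<and> x i \<le> t} = S} \<in> sets times"
  unfolding finished_eq[OF assms] by (intro sets_PiM_I_finite) auto

text \<open>By \<open>finished_eq\<close> the event is a box, so independence makes its probability
  a product over the servers.\<close>

lemma finished_prob:
  assumes S: "S \<subseteq> {..<n}"
  shows "measure times {x \<in> space times. {i. i < n \<and> x i \<le> t} = S}
           = F t ^ card S * (1 - F t) ^ (n - card S)"
proof -
  have fS: "finite S" using S finite_subset by blast
  have compl: "measure (run_time_law \<mu> k) {t<..} = 1 - F t"
  proof -
    have "{t<..} = space (run_time_law \<mu> k) - {..t}" by auto
    thus ?thesis using law.prob_compl[of "{..t}"] by (simp add: run_time_law_cdf[OF mu k])
  qed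
  have "measure times {x \<in> space times. {i. i < n \<and> x i \<le> t} = S}
      = (\<Prod>i<n. measure (run_time_law \<mu> k) (if i \<in> S then {..t} else {t<..}))"
    unfolding finished_eq[OF S] by (rule times.prob_times) auto
  also have "\<dots> = (\<Prod>i<n. if i \<in> S then F t else 1 - F t)"
    by (intro prod.cong) (auto simp: compl run_time_law_cdf[OF mu k])
  also have "\<dots> = (\<Prod>i\<in>{..<n} \<inter> S. F t) * (\<Prod>i\<in>{..<n} - S. 1 - F t)"
    by (subst prod.If_cases) (auto simp: Diff_eq)
  also have "{..<n} \<inter> S = S" using S by auto
  finally show ?thesis using card_Diff_subset[OF fS S] by simp
qed

text \<open>Splits the event by the exact finished set; the hypothesis leaves only finitely many
  disjoint pieces.\<close>

lemma finished_in:
  assumes "\<And>S. Q S \<Longrightarrow> S \<subseteq> {..<n}"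
  shows "{x \<in> space times. Q {i. i < n \<and> x i \<le> t}} \<in> sets times"
    and "measure times {x \<in> space times. Q {i. i < n \<and> x i \<le> t}}
           = (\<Sum>S | Q S. F t ^ card S * (1 - F t) ^ (n - card S))"
proof -
  have "{S. Q S} \<subseteq> Pow {..<n}" using assms by blast
  hence fin: "finite {S. Q S}" by (rule finite_subset) simp
  let ?E = "\<lambda>S. {x \<in> space times. {i. i < n \<and> x i \<le> t} = S}"
  have eq: "{x \<in> space times. Q {i. i < n \<and> x i \<le> t}} = (\<Union>S\<in>{S. Q S}. ?E S)" by auto
  have E: "?E S \<in> sets times" if "S \<in> {S. Q S}" for S
    using finished_sets[of S t] assms[of S] that by simp
  show "{x \<in> space times. Q {i. i < n \<and> x i \<le> t}} \<in> sets times"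
    unfolding eq using fin E by (intro sets.finite_UN) auto
  have "measure times (\<Union>S\<in>{S. Q S}. ?E S) = (\<Sum>S | Q S. measure times (?E S))"
    using fin E by (intro times.finite_measure_finite_Union) (auto simp: disjoint_family_on_def)
  also have "\<dots> = (\<Sum>S | Q S. F t ^ card S * (1 - F t) ^ (n - card S))"
    using assms by (intro sum.cong finished_prob) auto
  finally show "measure times {x \<in> space times. Q {i. i < n \<and> x i \<le> t}}
           = (\<Sum>S | Q S. F t ^ card S * (1 - F t) ^ (n - card S))"
    unfolding eq .
qed

lemma completion_time_measurable:
  assumes D: "decoder n D"
  shows "completion_time n D \<in> borel_measurable times"
proof (subst borel_measurable_iff_le, intro allI)
  fix t
  have "{x \<in> space times. completion_time n D x \<le> t}
      = {x \<in> space times. (\<lambda>S. S \<subseteq> {..<n} \<and> D S) {i. i < n \<and> x i \<le> t}}"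
    by (auto simp: completion_time_le_iff[OF D])
  also have "\<dots> \<in> sets times" by (rule finished_in(1)) simp
  finally show "{x \<in> space times. completion_time n D x \<le> t} \<in> sets times" .
qed

lemma prob_completion_time_gt:
  assumes D: "decoder n D"
  shows "measure times {x \<in> space times. t < completion_time n D x}
           = (\<Sum>S | S \<subseteq> {..<n} \<and> \<not> D S. F t ^ card S * (1 - F t) ^ (n - card S))"
proof -
  have "{x \<in> space times. t < completion_time n D x}
      = {x \<in> space times. (\<lambda>S. S \<subseteq> {..<n} \<and> \<not> D S) {i. i < n \<and> x i \<le> t}}"
    by (auto simp: completion_time_le_iff[OF D] not_le[symmetric])
  thus ?thesis by (simp only:) (rule finished_in(2), simp)
qed

text \<open>At time 0 we have \<open>F 0 = 0\<close>, so only the empty set has positive probability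
  (\<open>0 ^ 0 = 1\<close>), and it is undecodable. This justifies computing the mean as a
  nonnegative integral.\<close>

lemma completion_time_pos:
  assumes D: "decoder n D"
  shows "AE x in times. 0 < completion_time n D x"
proof -
  have "F 0 = 0" using k by (simp add: run_time_cdf_def)
  hence "measure times {x \<in> space times. 0 < completion_time n D x}
      = (\<Sum>S | S \<subseteq> {..<n} \<and> \<not> D S. 0 ^ card S)"
    by (simp add: prob_completion_time_gt[OF D])
  also have "\<dots> = (\<Sum>S\<in>{{} :: nat set}. 0 ^ card S)"
  proof (rule sum.mono_neutral_right)
    show "\<forall>S\<in>{S. S \<subseteq> {..<n} \<and> \<not> D S} - {{}}. (0::real) ^ card S = 0"
      using finite_subset[of _ "{..<n}"] by (auto simp: card_gt_0_iff)
  next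
    show "{{}} \<subseteq> {S. S \<subseteq> {..<n} \<and> \<not> D S}" using D by (simp add: decoder_def)
  qed simp
  finally have "measure times {x \<in> space times. 0 < completion_time n D x} = 1" by simp
  moreover have "{x \<in> space times. 0 < completion_time n D x} \<in> sets times"
    using completion_time_measurable[OF D] by measurable
  ultimately show ?thesis by (simp add: times.prob_Collect_eq_1)
qed

text \<open>The derivative of a lower binomial tail telescopes to its last term, so a multiple of this tail
  is an antiderivative of the integrand of \<open>tail_integral\<close>.\<close>
lemma binomial_cdf_has_derivative:
  fixes q :: "real \<Rightarrow> real"
  assumes q: "(q has_real_derivative - c * q t) (at t)" and m: "m < n"
  shows "((\<lambda>t. \<Sum>j\<le>m. (n choose j) * (1 - q t) ^ j * q t ^ (n - j)) has_real_derivative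
           - c * (real n - real m) * (n choose m) * (1 - q t) ^ m * q t ^ (n - m)) (at t)"
  using m
proof (induction m)
  case 0
  then obtain n' where "n = Suc n'" by (cases n) auto
  thus ?case using DERIV_power_Suc[OF q, of n'] by (simp add: algebra_simps)
next
  case (Suc m)
  define d where "d = n - Suc (Suc m)"
  have d: "n - m = Suc (Suc d)" "n - Suc m = Suc d" "real d + 1 = real n - real (Suc m)"
    using Suc.prems by (simp_all add: d_def of_nat_diff)
  \<comment> \<open>Absorption identity: the positive part of the derivative of the new summand
    cancels the derivative of the old sum.\<close>
  have ch: "real (n choose Suc m) * (real m + 1) = real (n choose m) * (real n - real m)"
  proof -
    have "Suc m * (n choose Suc m) = (n - m) * (n choose m)"
      by (simp only: binomial_absorption binomial_absorb_comp)
    hence "real (Suc m) * real (n choose Suc m) = real (n - m) * real (n choose m)"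
      by (metis of_nat_mult)
    thus ?thesis using Suc.prems by (simp add: algebra_simps)
  qed
  let ?B = "real (n choose m)" and ?B' = "real (n choose Suc m)" and ?p = "1 - q t"
  have "((\<lambda>t. ?B' * (1 - q t) ^ Suc m * q t ^ Suc d) has_real_derivative
      c * ?p ^ m * q t ^ Suc (Suc d) * (?B' * (real m + 1))
      - c * (real d + 1) * ?B' * ?p ^ Suc m * q t ^ Suc d) (at t)"
    by (rule derivative_eq_intros q refl)+ (simp add: algebra_simps)
  moreover have "((\<lambda>t. \<Sum>j\<le>m. (n choose j) * (1 - q t) ^ j * q t ^ (n - j)) has_real_derivative
      - c * (real n - real m) * ?B * ?p ^ m * q t ^ (n - m)) (at t)"
    using Suc by simp
  ultimately have "((\<lambda>t. (\<Sum>j\<le>m. (n choose j) * (1 - q t) ^ j * q t ^ (n - j))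
        + ?B' * (1 - q t) ^ Suc m * q t ^ Suc d) has_real_derivative
      - c * (real n - real m) * ?B * ?p ^ m * q t ^ (n - m)
      + (c * ?p ^ m * q t ^ Suc (Suc d) * (?B' * (real m + 1))
      - c * (real d + 1) * ?B' * ?p ^ Suc m * q t ^ Suc d)) (at t)"
    by (intro DERIV_add)
  also have "- c * (real n - real m) * ?B * ?p ^ m * q t ^ (n - m)
      + (c * ?p ^ m * q t ^ Suc (Suc d) * (?B' * (real m + 1))
      - c * (real d + 1) * ?B' * ?p ^ Suc m * q t ^ Suc d)
      = - c * (real n - real (Suc m)) * ?B' * ?p ^ Suc m * q t ^ Suc d"
    unfolding ch d(1,3) by (simp add: mult_ac)
  finally show ?case by (simp only: sum.atMost_Suc d(2))
qed

text \<open>Before \<open>1 / k\<close> the integrand is \<open>0 ^ m\<close>, which contributes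
  \<open>1 / k\<close> exactly when \<open>m = 0\<close>. From there on the antiderivative
  \<open>- A t / C\<close> rises from \<open>- 1 / C\<close> to 0.\<close>

lemma tail_integral:
  assumes m: "m < n"
  shows "(\<integral>\<^sup>+t. ennreal (F t ^ m * (1 - F t) ^ (n - m)) * indicator {0..} t \<partial>lborel)
           = ennreal (tail_weight m)"
proof -
  \<comment> \<open>This is \<open>1 - F t\<close> from \<open>1 / k\<close> on. Earlier it exceeds
    1, so \<open>f\<close> is claimed to be nonnegative only from \<open>1 / k\<close> on.\<close>
  define q where "q t = exp (- (\<mu> * (real k * t - 1)))" for t
  define f where "f t = (1 - q t) ^ m * q t ^ (n - m)" for t
  define c where "c = \<mu> * k"
  define A where "A t = (\<Sum>j\<le>m. (n choose j) * (1 - q t) ^ j * q t ^ (n - j))" for t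
  define C where "C = c * (real n - real m) * (n choose m)"
  have C: "C > 0" using mu k m by (simp add: C_def c_def)
  have q': "(q has_real_derivative - c * q t) (at t)" for t
    unfolding q_def[abs_def] by (auto intro!: derivative_eq_intros simp: c_def)
  have deriv: "((\<lambda>t. - A t / C) has_real_derivative f t) (at t)" for t
  proof -
    have "(A has_real_derivative - C * f t) (at t)"
      using binomial_cdf_has_derivative[OF q'[of t] m]
      by (simp add: A_def[abs_def] C_def f_def mult.assoc)
    from DERIV_cdivide[OF DERIV_minus[OF this], of C] show ?thesis using C by simp
  qed
  have q_lim: "(q \<longlongrightarrow> 0) at_top"
  proof -
    have "filterlim (\<lambda>t. real k * t) at_top at_top"
      using k by (intro filterlim_tendsto_pos_mult_at_top[OF tendsto_const] filterlim_ident) auto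
    hence "filterlim (\<lambda>t. - 1 + real k * t) at_top at_top"
      by (intro filterlim_tendsto_add_at_top[OF tendsto_const])
    hence "filterlim (\<lambda>t. \<mu> * (- 1 + real k * t)) at_top at_top"
      using mu by (intro filterlim_tendsto_pos_mult_at_top[OF tendsto_const]) auto
    hence "((\<lambda>t. exp (- (\<mu> * (- 1 + real k * t)))) \<longlongrightarrow> 0) at_top"
      by (intro filterlim_compose[OF exp_at_bot] filterlim_compose[OF filterlim_uminus_at_bot_at_top])
    thus ?thesis by (simp add: q_def[abs_def])
  qed
  have "(A \<longlongrightarrow> (\<Sum>j\<le>m. real (n choose j) * (1 - 0) ^ j * 0 ^ (n - j))) at_top"
    unfolding A_def[abs_def] by (intro tendsto_intros q_lim)
  also have "(\<Sum>j\<le>m. real (n choose j) * (1 - 0) ^ j * (0::real) ^ (n - j)) = 0"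
    using m by (intro sum.neutral) auto
  finally have lim: "((\<lambda>t. - A t / C) \<longlongrightarrow> 0) at_top"
    using tendsto_divide[OF tendsto_minus tendsto_const, of A 0 at_top C] C by simp
  have q1: "q (1 / k) = 1" using k by (simp add: q_def)
  \<comment> \<open>Here \<open>1 - q (1 / k) = 0\<close>, so only the summand \<open>j = 0\<close>
    survives.\<close>
  have "A (1 / k) = (\<Sum>j\<in>{0}. real (n choose j) * 0 ^ j)"
    unfolding A_def q1 by (intro sum.mono_neutral_cong_right) auto
  hence A1: "A (1 / k) = 1" by simp
  have q_le: "q t \<le> 1" if "1 / k \<le> t" for t
    using that mu k by (simp add: q_def field_simps)
  have f_nonneg: "0 \<le> f t" if "1 / k \<le> t" for t
    using q_le[OF that] by (simp add: f_def q_def)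
  have f_meas: "f \<in> borel_measurable borel"
    unfolding f_def[abs_def] q_def[abs_def] by measurable
  have main: "(\<integral>\<^sup>+t. ennreal (f t) * indicator {1 / k..} t \<partial>lborel) = ennreal (1 / C)"
    using nn_integral_FTC_atLeast[OF f_meas deriv f_nonneg lim] A1 by simp
  have head: "(\<integral>\<^sup>+t. ennreal (0 ^ m) * indicator {0..<1 / real k} t \<partial>lborel)
      = ennreal (if m = 0 then 1 / k else 0)"
    by (simp add: nn_integral_cmult)
  have "(\<integral>\<^sup>+t. ennreal (F t ^ m * (1 - F t) ^ (n - m)) * indicator {0..} t \<partial>lborel)
      = (\<integral>\<^sup>+t. ennreal (0 ^ m) * indicator {0..<1 / real k} t + ennreal (f t) * indicator {1 / k..} t \<partial>lborel)"
  proof (intro nn_integral_cong)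
    fix t :: real
    have "0 \<le> t" if "1 / real k \<le> t" using order_trans[OF _ that, of 0] by simp
    thus "ennreal (F t ^ m * (1 - F t) ^ (n - m)) * indicator {0..} t
      = ennreal (0 ^ m) * indicator {0..<1 / real k} t + ennreal (f t) * indicator {1 / k..} t"
      by (cases "t < 1 / real k") (auto simp: run_time_cdf_def f_def q_def indicator_def)
  qed
  also have "\<dots> = ennreal (if m = 0 then 1 / k else 0) + ennreal (1 / C)"
    using f_meas by (subst nn_integral_add) (auto simp: main head)
  also have "\<dots> = ennreal ((if m = 0 then 1 / k else 0) + 1 / C)"
    using C by (intro ennreal_plus[symmetric]) auto
  also have "(if m = 0 then 1 / k else 0) + 1 / C = tail_weight m"
    by (simp add: tail_weight_def C_def c_def field_simps)
  finally show ?thesis .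
qed

lemma tail_weight_nonneg: "m < n \<Longrightarrow> 0 \<le> tail_weight m"
  using mu by (simp add: tail_weight_def)

text \<open>Layer-cake formula \<open>E T = \<integral> P(T > t) dt\<close>.\<close>
lemma avg_time_eq_sum:
  assumes D: "decoder n D"
  shows "avg_time \<mu> n k D = (\<Sum>S | S \<subseteq> {..<n} \<and> \<not> D S. tail_weight (card S))"
proof -
  let ?T = "completion_time n D" and ?U = "{S. S \<subseteq> {..<n} \<and> \<not> D S}"
  note [measurable] = completion_time_measurable[OF D]
  interpret pair_sigma_finite times lborel ..
  \<comment> \<open>The full set is decodable, so every undecodable set is proper, as
    \<open>tail_integral\<close> requires.\<close>
  have card_U: "card S < n" if "S \<in> ?U" for S
  proof -
    have "S \<noteq> {..<n}" using that D by (auto simp only: decoder_def mem_Collect_eq)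
    thus ?thesis using that psubset_card_mono[of "{..<n}" S] by auto
  qed
  have "(\<integral>\<^sup>+x. ennreal (?T x) \<partial>times)
      = (\<integral>\<^sup>+x. \<integral>\<^sup>+t. indicator {0..} t * indicator {t. t < ?T x} t \<partial>lborel \<partial>times)"
  \<comment> \<open>This holds for negative completion times too: both sides are then 0.\<close>
  proof (intro nn_integral_cong)
    fix x
    have "(\<integral>\<^sup>+t. indicator {0..} t * indicator {t. t < ?T x} t \<partial>lborel)
        = (\<integral>\<^sup>+t. indicator {0..<?T x} t \<partial>lborel)"
      by (intro nn_integral_cong) (auto simp: indicator_def)
    also have "\<dots> = ennreal (?T x)"
      by (cases "0 \<le> ?T x") (auto simp: ennreal_neg)
    finally show "ennreal (?T x) = (\<integral>\<^sup>+t. indicator {0..} t * indicator {t. t < ?T x} t \<partial>lborel)" ..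
  qed
  also have "\<dots> = (\<integral>\<^sup>+t. \<integral>\<^sup>+x. indicator {0..} t * indicator {t. t < ?T x} t \<partial>times \<partial>lborel)"
    by (rule Fubini'[symmetric]) measurable
  also have "\<dots> = (\<integral>\<^sup>+t. (\<Sum>S\<in>?U. ennreal (F t ^ card S * (1 - F t) ^ (n - card S)) * indicator {0..} t) \<partial>lborel)"
  proof (intro nn_integral_cong)
    fix t :: real
    have "(\<integral>\<^sup>+x. indicator {0..} t * indicator {t. t < ?T x} t \<partial>times)
        = (\<integral>\<^sup>+x. indicator {0..} t * indicator {x \<in> space times. t < ?T x} x \<partial>times)"
      by (intro nn_integral_cong) (auto simp: indicator_def)
    also have "\<dots> = indicator {0..} t * emeasure times {x \<in> space times. t < ?T x}"
      by (subst nn_integral_cmult) auto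
    also have "emeasure times {x \<in> space times. t < ?T x}
        = (\<Sum>S\<in>?U. ennreal (F t ^ card S * (1 - F t) ^ (n - card S)))"
      using F_nonneg[of t] F_le_1[of t]
      by (simp add: times.emeasure_eq_measure prob_completion_time_gt[OF D])
    finally show "(\<integral>\<^sup>+x. indicator {0..} t * indicator {t. t < ?T x} t \<partial>times)
        = (\<Sum>S\<in>?U. ennreal (F t ^ card S * (1 - F t) ^ (n - card S)) * indicator {0..} t)"
      by (simp add: sum_distrib_left mult.commute)
  qed
  also have "\<dots> = (\<Sum>S\<in>?U. \<integral>\<^sup>+t. ennreal (F t ^ card S * (1 - F t) ^ (n - card S)) * indicator {0..} t \<partial>lborel)"
    by (intro nn_integral_sum) (simp add: run_time_cdf_def)
  also have "\<dots> = (\<Sum>S\<in>?U. ennreal (tail_weight (card S)))"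
    by (intro sum.cong tail_integral card_U) auto
  also have "\<dots> = ennreal (\<Sum>S\<in>?U. tail_weight (card S))"
    by (intro sum_ennreal tail_weight_nonneg card_U)
  finally have nn: "(\<integral>\<^sup>+x. ennreal (?T x) \<partial>times) = ennreal (\<Sum>S\<in>?U. tail_weight (card S))" .
  have "AE x in times. 0 \<le> ?T x"
    using completion_time_pos[OF D] by eventually_elim simp
  hence "avg_time \<mu> n k D = enn2real (\<integral>\<^sup>+x. ennreal (?T x) \<partial>times)"
    unfolding avg_time_def by (intro integral_eq_nn_integral) auto
  also have "\<dots> = (\<Sum>S\<in>?U. tail_weight (card S))"
    unfolding nn by (intro enn2real_ennreal sum_nonneg tail_weight_nonneg card_U)
  finally show ?thesis .
qed

end

section \<open>The gap between random and MDS codes\<close>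

lemma
  assumes G: "G \<in> full_rank_mats n k" and k: "0 < k"
  shows decodable_card_ge: "S \<subseteq> {..<n} \<Longrightarrow> decodable k G S \<Longrightarrow> k \<le> card S"
    and decoder_decodable: "decoder n (decodable k G)"
proof -
  have Gc: "G \<in> carrier_mat k n" using G by (simp add: full_rank_mats_def)
  show le: "k \<le> card S" if "S \<subseteq> {..<n}" "decodable k G S" for S
  proof (rule spanning_card_le)
    show "spanning k (col G) S" using decodable_iff_spanning[OF Gc that(1)] that(2) by simp
    show "finite S" using that(1) finite_subset by blast
    have "col G j \<in> carrier_vec k" for j using col_dim[of G j] Gc by simp
    thus "col G ` S \<subseteq> carrier_vec k" by blast
  qed
  have "decodable k G B" if "A \<subseteq> B" "B \<subseteq> {..<n}" "decodable k G A" for A B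
    using that spanning_mono[of k "col G" A B] decodable_iff_spanning[OF Gc] by simp
  moreover have "decodable k G {..<n}"
    using G decodable_iff_spanning[OF Gc] full_rank_iff_spanning[OF Gc] by simp
  moreover have "\<not> decodable k G {}" using le[of "{}"] k by auto
  ultimately show "decoder n (decodable k G)" unfolding decoder_def by blast
qed

lemma decoder_card_ge:
  assumes "0 < k" "k \<le> n"
  shows "decoder n (\<lambda>S. k \<le> card S)"
proof -
  have "k \<le> card B" if "A \<subseteq> B" "B \<subseteq> {..<n}" "k \<le> card A" for A B
    using that card_mono[of B A] finite_subset[of B "{..<n}"] by simp
  thus ?thesis using assms by (simp add: decoder_def)
qed

section \<open>Bounds on the failure probability\<close>

definition failure_prob :: "nat \<Rightarrow> nat \<Rightarrow> nat set \<Rightarrow> real" where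
  "failure_prob n k S = card {G \<in> full_rank_mats n k. \<not> decodable k G S} / card (full_rank_mats n k)"

lemma card_full_rank_eq:
  assumes S: "S \<subseteq> {..<n}"
  shows "card {G \<in> full_rank_mats n k. \<not> decodable k G S}
      = card {g \<in> col_families n k. spanning k g {..<n} \<and> \<not> spanning k g S}"
    and "card (full_rank_mats n k) = card {g \<in> col_families n k. spanning k g {..<n}}"
proof -
  have sp: "spanning k (restrict (col G) {..<n}) A = spanning k (col G) A" if "A \<subseteq> {..<n}"
    for G :: "bit mat" and A
    by (rule spanning_cong) (use that in auto)
  have W: "full_rank_mats n k = {G \<in> carrier_mat k n. spanning k (col G) {..<n}}"
    using full_rank_iff_spanning[of _ k n] by (auto simp: full_rank_mats_def)
  have "{G \<in> full_rank_mats n k. \<not> decodable k G S}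
      = {G \<in> carrier_mat k n. spanning k (col G) {..<n} \<and> \<not> spanning k (col G) S}"
    unfolding W using decodable_iff_spanning[OF _ S] by auto
  thus "card {G \<in> full_rank_mats n k. \<not> decodable k G S}
      = card {g \<in> col_families n k. spanning k g {..<n} \<and> \<not> spanning k g S}"
    by (simp only:) (intro card_mats_eq_card_col_families, simp add: sp S)
  show "card (full_rank_mats n k) = card {g \<in> col_families n k. spanning k g {..<n}}"
    unfolding W by (intro card_mats_eq_card_col_families) (simp add: sp)
qed

text \<open>The union bound \<open>not_spanning_card\<close>, applied to the set of all
  columns.\<close>

lemma card_full_rank_ge:
  "real (2 ^ (k * n)) * (1 - 2 ^ k / 2 ^ n) \<le> card (full_rank_mats n k)"
proof -
  let ?A = "{g \<in> col_families n k. spanning k g {..<n}}"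
    and ?B = "{g \<in> col_families n k. \<not> spanning k g {..<n}}"
  have "card ?A + card ?B = card (col_families n k)"
    by (subst card_Un_disjoint[symmetric]) (auto simp: col_families_finite intro!: arg_cong[of _ _ card])
  hence "real (card ?A) + real (card ?B) = 2 ^ (k * n)"
    by (simp add: col_families_card flip: of_nat_add)
  moreover have "card ?B * 2 ^ n \<le> 2 ^ k * 2 ^ (k * n)"
    using not_spanning_card[of "{..<n}" n k] by simp
  hence "real (card ?B * 2 ^ n) \<le> real (2 ^ k * 2 ^ (k * n))" by (rule of_nat_mono)
  hence "real (card ?B) \<le> 2 ^ k * 2 ^ (k * n) / 2 ^ n" by (simp add: field_simps)
  ultimately show ?thesis
    by (simp add: card_full_rank_eq(2)[of "{}"] algebra_simps)
qed

text \<open>For \<open>k < n\<close> at least half of all matrices have full rank, so conditioning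
  on full rank at most doubles the union bound.\<close>

lemma failure_prob_le:
  assumes S: "S \<subseteq> {..<n}" and kn: "k < n"
  shows "failure_prob n k S \<le> 2 * 2 ^ k / 2 ^ card S"
proof -
  have "card {G \<in> full_rank_mats n k. \<not> decodable k G S} \<le> card {g \<in> col_families n k. \<not> spanning k g S}"
    unfolding card_full_rank_eq(1)[OF S] by (intro card_mono) (auto simp: col_families_finite)
  hence "card {G \<in> full_rank_mats n k. \<not> decodable k G S} * 2 ^ card S \<le> 2 ^ k * 2 ^ (k * n)"
    using not_spanning_card[OF S, of k] by (meson le_trans mult_le_mono1)
  hence "real (card {G \<in> full_rank_mats n k. \<not> decodable k G S} * 2 ^ card S) \<le> real (2 ^ k * 2 ^ (k * n))"
    by (rule of_nat_mono)
  hence a: "real (card {G \<in> full_rank_mats n k. \<not> decodable k G S}) \<le> 2 ^ k * 2 ^ (k * n) / 2 ^ card S"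
    by (simp add: field_simps)
  have "(2::real) ^ Suc k \<le> 2 ^ n" using kn by (intro power_increasing) auto
  hence "(1/2::real) \<le> 1 - 2 ^ k / 2 ^ n" by (simp add: field_simps)
  hence "real (2 ^ (k * n)) * (1/2) \<le> real (2 ^ (k * n)) * (1 - 2 ^ k / 2 ^ n)"
    by (intro mult_left_mono) auto
  hence b: "real (2 ^ (k * n)) * (1/2) \<le> card (full_rank_mats n k)"
    using card_full_rank_ge[of k n] by linarith
  have "failure_prob n k S \<le> (2 ^ k * 2 ^ (k * n) / 2 ^ card S) / (real (2 ^ (k * n)) * (1/2))"
    unfolding failure_prob_def by (rule frac_le[OF _ a _ b]) auto
  also have "\<dots> = 2 * 2 ^ k / 2 ^ card S" by simp
  finally show ?thesis .
qed

text \<open>At least half of all families fail to span on \<open>S\<close>, and at most a quarter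
  fail on all columns because \<open>k + 2 \<le> n\<close>. The remaining quarter has full rank and
  fails on \<open>S\<close>.\<close>

lemma failure_prob_ge:
  assumes S: "S \<subseteq> {..<n}" "card S = k" and k: "0 < k" "k + 2 \<le> n"
  shows "1 / 4 \<le> failure_prob n k S"
proof -
  let ?A = "{g \<in> col_families n k. spanning k g {..<n} \<and> \<not> spanning k g S}"
    and ?B = "{g \<in> col_families n k. \<not> spanning k g {..<n}}"
    and ?C = "{g \<in> col_families n k. \<not> spanning k g S}"
  have "card ?C \<le> card (?A \<union> ?B)" by (intro card_mono) (auto simp: col_families_finite)
  also have "\<dots> \<le> card ?A + card ?B" by (rule card_Un_le)
  finally have 1: "real (card ?C) \<le> card ?A + card ?B" by linarith
  have "real (2 ^ (k * n)) \<le> real (2 * card ?C)"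
    using spanning_card_half[OF S k(1)] by (rule of_nat_mono)
  hence 2: "(2::real) ^ (k * n) \<le> 2 * card ?C" by simp
  have "card ?B * 2 ^ n \<le> 2 ^ k * 2 ^ (k * n)"
    using not_spanning_card[of "{..<n}" n k] by simp
  hence "real (card ?B * 2 ^ n) \<le> real (2 ^ k * 2 ^ (k * n))" by (rule of_nat_mono)
  hence "real (card ?B) * 2 ^ n \<le> 2 ^ k * 2 ^ (k * n)" by simp
  moreover have "(2::real) ^ (k + 2) \<le> 2 ^ n" using k by (intro power_increasing) auto
  hence "real (card ?B) * 2 ^ (k + 2) \<le> real (card ?B) * 2 ^ n" by (intro mult_left_mono) auto
  ultimately have "real (card ?B) * 2 ^ (k + 2) \<le> 2 ^ k * 2 ^ (k * n)" by linarith
  hence "4 * real (card ?B) * 2 ^ k \<le> 2 ^ (k * n) * 2 ^ k" by (simp add: power_add mult_ac)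
  hence 3: "4 * real (card ?B) \<le> 2 ^ (k * n)" by (rule mult_right_le_imp_le) simp
  have 4: "(2::real) ^ (k * n) / 4 \<le> card ?A" using 1 2 3 by linarith
  have W: "card (full_rank_mats n k) > 0"
    using full_rank_mats_nonempty[of k n] full_rank_mats_finite[of n k] k by (simp add: card_gt_0_iff)
  have "card (full_rank_mats n k) \<le> card (col_families n k)"
    unfolding card_full_rank_eq(2)[OF S(1)] by (intro card_mono) (auto simp: col_families_finite)
  hence "real (card (full_rank_mats n k)) \<le> real (2 ^ (k * n))"
    unfolding col_families_card by (rule of_nat_mono)
  hence "real (card (full_rank_mats n k)) \<le> 2 ^ (k * n)" by (simp only: of_nat_power of_nat_numeral)
  hence "card (full_rank_mats n k) * (1 / 4) \<le> real (card ?A)" using 4 by linarith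
  thus ?thesis using W by (simp add: failure_prob_def card_full_rank_eq(1)[OF S(1)] field_simps)
qed

lemma sum_over_subsets_by_card:
  "(\<Sum>S | S \<subseteq> {..<n} \<and> k \<le> card S. f (card S)) = (\<Sum>m=k..n. (n choose m) * (f m :: real))"
proof -
  let ?I = "{S. S \<subseteq> {..<n} \<and> k \<le> card S}"
  have fin: "finite ?I" by (rule finite_subset[of _ "Pow {..<n}"]) auto
  have "card ` ?I \<subseteq> {k..n}" using card_mono[of "{..<n}"] by fastforce
  hence "(\<Sum>S\<in>?I. f (card S)) = (\<Sum>m=k..n. \<Sum>S | S \<in> ?I \<and> card S = m. f (card S))"
    by (intro sum.group[symmetric] fin) auto
  also have "\<dots> = (\<Sum>m=k..n. (n choose m) * f m)"
  proof (intro sum.cong refl)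
    fix m assume "m \<in> {k..n}"
    hence "{S. S \<in> ?I \<and> card S = m} = {S. S \<subseteq> {..<n} \<and> card S = m}" by auto
    moreover have "card {S. S \<subseteq> {..<n} \<and> card S = m} = n choose m"
      using n_subsets[of "{..<n}" m] by simp
    ultimately show "(\<Sum>S | S \<in> ?I \<and> card S = m. f (card S)) = (n choose m) * f m" by simp
  qed
  finally show ?thesis .
qed

section \<open>The gap as a weighted sum of failure probabilities\<close>

context run_times
begin

text \<open>Sets with fewer than \<open>k\<close> elements are undecodable for every code of full
  rank and for MDS codes, so they cancel. The remaining sets are undecodable only for the random
  code; exchanging the sums over codes and sets gives the probabilities.\<close>

lemma T_BRC_minus_T_MDS:
  assumes kn: "k \<le> n"
  shows "T_BRC \<mu> n k - T_MDS \<mu> n k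
    = (\<Sum>S | S \<subseteq> {..<n} \<and> k \<le> card S. tail_weight (card S) * failure_prob n k S)"
proof -
  let ?W = "full_rank_mats n k" and ?I = "{S. S \<subseteq> {..<n} \<and> k \<le> card S}"
  let ?w = "\<lambda>S. tail_weight (card S)"
  have fin: "finite {S. S \<subseteq> {..<n} \<and> P S}" for P
    by (rule finite_subset[of _ "Pow {..<n}"]) auto
  have W: "?W \<noteq> {}" "finite ?W" using full_rank_mats_nonempty[OF kn] full_rank_mats_finite by auto
  hence cW: "card ?W > 0" by (simp add: card_gt_0_iff)
  have diff: "avg_time \<mu> n k (decodable k G) = T_MDS \<mu> n k
      + (\<Sum>S\<in>?I. if decodable k G S then 0 else ?w S)" if G: "G \<in> ?W" for G
  proof -
    have "{S. S \<subseteq> {..<n} \<and> \<not> decodable k G S}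
        = {S. S \<subseteq> {..<n} \<and> \<not> k \<le> card S} \<union> {S. S \<subseteq> {..<n} \<and> k \<le> card S \<and> \<not> decodable k G S}"
      using decodable_card_ge[OF G k] by blast
    hence "avg_time \<mu> n k (decodable k G) = sum ?w {S. S \<subseteq> {..<n} \<and> \<not> k \<le> card S}
        + sum ?w {S. S \<subseteq> {..<n} \<and> k \<le> card S \<and> \<not> decodable k G S}"
      unfolding avg_time_eq_sum[OF decoder_decodable[OF G k]]
      by (simp only:) (intro sum.union_disjoint fin, blast)
    also have "sum ?w {S. S \<subseteq> {..<n} \<and> \<not> k \<le> card S} = T_MDS \<mu> n k"
      unfolding T_MDS_def avg_time_eq_sum[OF decoder_card_ge[OF k kn]] ..
    also have "sum ?w {S. S \<subseteq> {..<n} \<and> k \<le> card S \<and> \<not> decodable k G S}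
        = (\<Sum>S\<in>?I. if decodable k G S then 0 else ?w S)"
      using fin by (intro sum.mono_neutral_cong_left) auto
    finally show ?thesis .
  qed
  have "T_BRC \<mu> n k = (\<Sum>G\<in>?W. avg_time \<mu> n k (decodable k G)) / card ?W"
    unfolding T_BRC_def by (rule integral_pmf_of_set[OF W])
  also have "\<dots> = T_MDS \<mu> n k + (\<Sum>G\<in>?W. \<Sum>S\<in>?I. if decodable k G S then 0 else ?w S) / card ?W"
    using cW by (simp add: diff sum.distrib add_divide_distrib)
  also have "(\<Sum>G\<in>?W. \<Sum>S\<in>?I. if decodable k G S then 0 else ?w S)
      = (\<Sum>S\<in>?I. \<Sum>G\<in>?W. if decodable k G S then 0 else ?w S)"
    by (rule sum.swap)
  also have "\<dots> = (\<Sum>S\<in>?I. ?w S * card {G \<in> ?W. \<not> decodable k G S})"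
  proof (intro sum.cong refl)
    fix S
    have "(\<Sum>G\<in>?W. if decodable k G S then 0 else ?w S) = (\<Sum>G\<in>{G \<in> ?W. \<not> decodable k G S}. ?w S)"
      using W by (intro sum.mono_neutral_cong_right) auto
    thus "(\<Sum>G\<in>?W. if decodable k G S then 0 else ?w S) = ?w S * card {G \<in> ?W. \<not> decodable k G S}"
      by simp
  qed
  finally show ?thesis by (simp add: failure_prob_def sum_divide_distrib)
qed

text \<open>For \<open>m = n\<close> both sides are 0 by the convention for division by zero, so
  sums may run up to \<open>n\<close>.\<close>

lemma choose_tail_weight:
  assumes "0 < m" "m \<le> n"
  shows "(n choose m) * tail_weight m = 1 / (\<mu> * k * (real n - real m))"
  using assms by (simp add: tail_weight_def)

end

section \<open>Explicit bounds on the gap\<close>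

lemma sum_Suc_div_power2: "(\<Sum>j\<le>N. (1 + real j) / 2 ^ j) = 4 - (real N + 3) / 2 ^ N"
  by (induction N) (simp_all add: field_simps)

text \<open>Since \<open>(d - j) * (1 + j) \<ge> d\<close>; the term \<open>j = d\<close> is \<open>1 / 0 = 0\<close>.\<close>
lemma sum_inverse_div_power2_le:
  assumes d: "0 < d"
  shows "(\<Sum>j\<le>d. 1 / (real d - real j) / 2 ^ j) \<le> 4 / d"
proof -
  have "1 / (real d - real j) / 2 ^ j \<le> (1 + real j) / 2 ^ j / d" if "j \<le> d" for j
  proof (cases "j = d")
    case False
    hence jd: "real j + 1 \<le> real d" using that by linarith
    hence "0 \<le> real j * (real d - 1 - real j)" by simp
    hence "real d \<le> (1 + real j) * (real d - real j)" by (simp add: algebra_simps)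
    hence "1 / (real d - real j) \<le> (1 + real j) / d" using jd d by (simp add: field_simps)
    hence "1 / (real d - real j) / 2 ^ j \<le> (1 + real j) / d / 2 ^ j"
      by (intro divide_right_mono) auto
    thus ?thesis by (simp add: mult.commute)
  qed simp
  hence "(\<Sum>j\<le>d. 1 / (real d - real j) / 2 ^ j) \<le> (\<Sum>j\<le>d. (1 + real j) / 2 ^ j / d)"
    by (intro sum_mono) auto
  also have "\<dots> = (\<Sum>j\<le>d. (1 + real j) / 2 ^ j) / d" by (simp add: sum_divide_distrib)
  also have "\<dots> \<le> 4 / d" unfolding sum_Suc_div_power2 by (intro divide_right_mono) auto
  finally show ?thesis .
qed

text \<open>Below, the sets of size \<open>k\<close> alone suffice. Above, the failure probability
  halves with every extra symbol, which outweighs the growth of \<open>1 / (n - m)\<close>.\<close>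

lemma T_BRC_minus_T_MDS_bounds:
  assumes mu: "0 < \<mu>" and kn: "0 < k" "k + 2 \<le> n"
  shows "1 / (4 * \<mu> * k * (real n - real k)) \<le> T_BRC \<mu> n k - T_MDS \<mu> n k"
    and "T_BRC \<mu> n k - T_MDS \<mu> n k \<le> 8 / (\<mu> * k * (real n - real k))"
proof -
  interpret run_times \<mu> n k by unfold_locales (use mu kn in auto)
  let ?I = "{S. S \<subseteq> {..<n} \<and> k \<le> card S}"
  have fin: "finite ?I" by (rule finite_subset[of _ "Pow {..<n}"]) auto
  have diff: "T_BRC \<mu> n k - T_MDS \<mu> n k = (\<Sum>S\<in>?I. tail_weight (card S) * failure_prob n k S)"
    using kn by (intro T_BRC_minus_T_MDS) simp
  have w: "0 \<le> tail_weight m" if "m \<le> n" for m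
    using that mu by (simp add: tail_weight_def)
  have cn: "card S \<le> n" if "S \<in> ?I" for S
    using that card_mono[of "{..<n}" S] by simp
  have p: "0 \<le> failure_prob n k S" for S by (simp add: failure_prob_def)
  have "1 / (4 * \<mu> * k * (real n - real k)) = (n choose k) * tail_weight k * (1 / 4)"
    using choose_tail_weight[of k] kn by simp
  also have "\<dots> = (\<Sum>S | S \<subseteq> {..<n} \<and> card S = k. tail_weight (card S) * (1 / 4))"
    using n_subsets[of "{..<n}" k] by simp
  also have "\<dots> \<le> (\<Sum>S | S \<subseteq> {..<n} \<and> card S = k. tail_weight (card S) * failure_prob n k S)"
    using kn by (intro sum_mono mult_left_mono failure_prob_ge w) auto
  \<comment> \<open>Adds the sets with more than \<open>k\<close> elements, whose terms are
    nonnegative.\<close>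
  also have "\<dots> \<le> (\<Sum>S\<in>?I. tail_weight (card S) * failure_prob n k S)"
    using fin w p cn by (intro sum_mono2 mult_nonneg_nonneg) auto
  finally show "1 / (4 * \<mu> * k * (real n - real k)) \<le> T_BRC \<mu> n k - T_MDS \<mu> n k"
    unfolding diff .
  have "(\<Sum>S\<in>?I. tail_weight (card S) * failure_prob n k S)
      \<le> (\<Sum>S\<in>?I. tail_weight (card S) * (2 * 2 ^ k / 2 ^ card S))"
    using kn w cn by (intro sum_mono mult_left_mono failure_prob_le) auto
  also have "\<dots> = (\<Sum>m=k..n. (n choose m) * (tail_weight m * (2 * 2 ^ k / 2 ^ m)))"
    by (rule sum_over_subsets_by_card)
  also have "\<dots> = (\<Sum>m=k..n. 1 / (\<mu> * k * (real n - real m)) * (2 * 2 ^ k / 2 ^ m))"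
  proof (intro sum.cong refl)
    fix m assume "m \<in> {k..n}"
    hence "0 < m" "m \<le> n" using kn by auto
    from choose_tail_weight[OF this]
    show "(n choose m) * (tail_weight m * (2 * 2 ^ k / 2 ^ m))
        = 1 / (\<mu> * k * (real n - real m)) * (2 * 2 ^ k / 2 ^ m)"
      by (simp only: mult.assoc[symmetric])
  qed
  \<comment> \<open>Reindexes by the excess \<open>j = m - k\<close>, after which
    \<open>2 ^ k\<close> cancels.\<close>
  also have "\<dots> = (\<Sum>j\<le>n - k. 1 / (\<mu> * k * (real n - real (k + j))) * (2 * 2 ^ k / 2 ^ (k + j)))"
    using kn by (intro sum.reindex_bij_witness[of _ "\<lambda>j. k + j" "\<lambda>m. m - k"]) auto
  also have "\<dots> = (\<Sum>j\<le>n - k. 2 / (\<mu> * k) * (1 / (real (n - k) - real j) / 2 ^ j))"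
    using kn by (intro sum.cong refl) (simp add: power_add of_nat_diff algebra_simps)
  also have "\<dots> = 2 / (\<mu> * k) * (\<Sum>j\<le>n - k. 1 / (real (n - k) - real j) / 2 ^ j)"
    by (simp only: sum_distrib_left)
  also have "\<dots> \<le> 2 / (\<mu> * k) * (4 / real (n - k))"
    using mu kn by (intro mult_left_mono sum_inverse_div_power2_le) auto
  also have "\<dots> = 8 / (\<mu> * k * (real n - real k))" using kn by (simp add: of_nat_diff)
  finally show "T_BRC \<mu> n k - T_MDS \<mu> n k \<le> 8 / (\<mu> * k * (real n - real k))"
    unfolding diff .
qed

text \<open>With \<open>k = n R\<close> the denominator \<open>\<mu> k (n - k)\<close> equals
  \<open>c n n\<close>, so multiplying the gap by \<open>n\<close> leaves order
  \<open>1 / n\<close>.\<close>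

lemma normalized_bounds:
  fixes \<mu> R :: real
  defines "c \<equiv> \<mu> * R * (1 - R)"
  assumes mu: "0 < \<mu>" and R: "0 < R" "R < 1"
    and n: "0 < n" "2 / (1 - R) \<le> real n" and k: "real k = real n * R"
  shows "1 / (4 * c) * (1 / n) \<le> \<bar>n * T_MDS \<mu> n k - n * T_BRC \<mu> n k\<bar>"
    and "\<bar>n * T_MDS \<mu> n k - n * T_BRC \<mu> n k\<bar> \<le> 8 / c * (1 / n)"
proof -
  have c: "0 < c" using mu R by (simp add: c_def)
  have "0 < real k" using n R k by simp
  \<comment> \<open>The threshold on \<open>n\<close> says exactly that \<open>n - k\<close> is at
    least 2.\<close>
  moreover have "2 \<le> real n * (1 - R)" using n(2) R by (simp add: field_simps)
  hence "real (k + 2) \<le> real n" using k by (simp add: algebra_simps)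
  ultimately have kn: "0 < k" "k + 2 \<le> n" by (simp_all only: of_nat_0_less_iff of_nat_le_iff)
  have prod: "\<mu> * k * (real n - real k) = c * real n * real n"
    by (simp add: k c_def algebra_simps)
  let ?d = "T_BRC \<mu> n k - T_MDS \<mu> n k"
  have lo: "1 / (4 * c * real n * real n) \<le> ?d"
    using T_BRC_minus_T_MDS_bounds(1)[OF mu kn] prod by (simp add: mult.assoc)
  have hi: "?d \<le> 8 / (c * real n * real n)"
    using T_BRC_minus_T_MDS_bounds(2)[OF mu kn] prod by simp
  have "0 \<le> 1 / (4 * c * real n * real n)" using c by simp
  hence "0 \<le> ?d" using lo by linarith
  hence "0 \<le> n * ?d" by simp
  moreover have "n * T_MDS \<mu> n k - n * T_BRC \<mu> n k = - (n * ?d)" by (simp add: algebra_simps)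
  ultimately have abs: "\<bar>n * T_MDS \<mu> n k - n * T_BRC \<mu> n k\<bar> = n * ?d" by linarith
  have "n * (1 / (4 * c * real n * real n)) \<le> n * ?d" using lo by (rule mult_left_mono) simp
  thus "1 / (4 * c) * (1 / n) \<le> \<bar>n * T_MDS \<mu> n k - n * T_BRC \<mu> n k\<bar>"
    unfolding abs using n(1) c by simp
  have "n * ?d \<le> n * (8 / (c * real n * real n))" using hi by (rule mult_left_mono) simp
  thus "\<bar>n * T_MDS \<mu> n k - n * T_BRC \<mu> n k\<bar> \<le> 8 / c * (1 / n)"
    unfolding abs using n(1) c by simp
qed

text \<open>Quantifying over \<open>k\<close> with \<open>real k = real n * R\<close> selects the
  \<open>n\<close> for which \<open>n R\<close> is an integer; at other \<open>n\<close> the claims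
  are vacuous. The limit is therefore stated with an explicit \<open>\<epsilon>\<close>.\<close>

theorem corollary8:
  fixes \<mu> R :: real
  assumes "0 < \<mu>" and "0 < R" and "R < 1"
  shows "(\<exists>c1 c2 :: real. 0 < c1 \<and> 0 < c2 \<and>
            (\<forall>\<^sub>F n in sequentially. \<forall>k. real k = real n * R \<longrightarrow>
               c1 * (1 / real n) \<le> \<bar>real n * T_MDS \<mu> n k - real n * T_BRC \<mu> n k\<bar> \<and>
               \<bar>real n * T_MDS \<mu> n k - real n * T_BRC \<mu> n k\<bar> \<le> c2 * (log 2 (real n) / real n)))
       \<and> (\<forall>\<epsilon>>0. \<forall>\<^sub>F n in sequentially. \<forall>k. real k = real n * R \<longrightarrow>
               \<bar>real n * T_BRC \<mu> n k - real n * T_MDS \<mu> n k\<bar> < \<epsilon>)"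
proof -
  define c where "c = \<mu> * R * (1 - R)"
  have c: "0 < c" using assms by (simp add: c_def)
  note bounds = normalized_bounds[OF assms, folded c_def]
  have large: "\<forall>\<^sub>F n in sequentially. 0 < n \<and> 2 / (1 - R) \<le> real n \<and> 1 \<le> log 2 (real n)"
    by (intro eventually_conj eventually_gt_at_top) real_asymp+
  have "\<forall>\<^sub>F n in sequentially. \<forall>k. real k = real n * R \<longrightarrow>
      1 / (4 * c) * (1 / real n) \<le> \<bar>real n * T_MDS \<mu> n k - real n * T_BRC \<mu> n k\<bar> \<and>
      \<bar>real n * T_MDS \<mu> n k - real n * T_BRC \<mu> n k\<bar> \<le> 8 / c * (log 2 (real n) / real n)"
    using large
  proof eventually_elim
    case (elim n)
    \<comment> \<open>The upper bound of order \<open>1 / n\<close> is weakened to the stated one by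
      \<open>1 \<le> log 2 n\<close>.\<close>
    have le: "8 / c * (1 / n) \<le> 8 / c * (log 2 n / n)"
      using elim c by (intro mult_left_mono divide_right_mono) auto
    show ?case
    proof (intro allI impI)
      fix k :: nat assume k: "real k = real n * R"
      show "1 / (4 * c) * (1 / real n) \<le> \<bar>real n * T_MDS \<mu> n k - real n * T_BRC \<mu> n k\<bar> \<and>
          \<bar>real n * T_MDS \<mu> n k - real n * T_BRC \<mu> n k\<bar> \<le> 8 / c * (log 2 (real n) / real n)"
        using bounds[OF _ _ k] elim le by linarith
    qed
  qed
  moreover have "\<forall>\<^sub>F n in sequentially. \<forall>k. real k = real n * R \<longrightarrow>
      \<bar>real n * T_BRC \<mu> n k - real n * T_MDS \<mu> n k\<bar> < \<epsilon>" if "\<epsilon> > 0" for \<epsilon>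
  proof -
    \<comment> \<open>Convergence follows from the sharper upper bound, without the
      logarithm.\<close>
    have "(\<lambda>n. 8 / c * (1 / real n)) \<longlonglongrightarrow> 0" by real_asymp
    hence "\<forall>\<^sub>F n in sequentially. 8 / c * (1 / real n) < \<epsilon>"
      using that by (rule order_tendstoD)
    with large show ?thesis
    proof eventually_elim
      case (elim n)
      show ?case
      proof (intro allI impI)
        fix k :: nat assume "real k = real n * R"
        hence "\<bar>real n * T_MDS \<mu> n k - real n * T_BRC \<mu> n k\<bar> < \<epsilon>"
          using bounds[of n k] elim by linarith
        thus "\<bar>real n * T_BRC \<mu> n k - real n * T_MDS \<mu> n k\<bar> < \<epsilon>"
          by (simp only: abs_minus_commute)
      qed
    qed
  qed
  moreover have "0 < 1 / (4 * c)" "0 < 8 / c" using c by simp_all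
  ultimately show ?thesis by blast
qed

end
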